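(* Let $(H;(\cdot,\cdot))$ be an inner product space over $\mathbb{K}$, where $\mathbb{K}=\mathbb{R}$ or $\mathbb{K}=\mathbb{C}$, let $n\ge1$ and let $x,y_1,\dots,y_n\in H$. Then $$\sum_{i=1}^n|(x,y_i)|^2\le\|x\|^2\Big\{\max_{1\le i\le n}\|y_i\|^2+(n-1)\max_{1\le i\ne j\le n}|(y_i,y_j)|\Big\}.$$
   Context: Here $\|v\|=(v,v)^{1/2}$. The maximum over $1\le i\ne j\le n$ ranges over all ordered pairs $(i,j)\in\{1,\dots,n\}^2$ with $i\neq j$; for $n=1$ this (empty) maximum is read as $0$. *)

theory Defs
  imports "HOL-Analysis.Inner_Product"
begin

text \<open>
  Real inner product spaces are the library class \<open>real_inner\<close>.  The complex case is not in the
  library; it is introduced here with the inner product linear in its \<^emph>\<open>first\<close> argument.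
\<close>

locale complex_inner_product_space = vector_space scale
  for scale :: "complex \<Rightarrow> 'v::ab_group_add \<Rightarrow> 'v" +
  fixes ip :: "'v \<Rightarrow> 'v \<Rightarrow> complex"
  assumes ip_add_left: "ip (u + v) w = ip u w + ip v w"
    and ip_scale_left: "ip (scale c u) w = c * ip u w"
    and ip_commute: "ip u v = cnj (ip v u)"
    and ip_self_nonneg: "ip u u \<in> \<real> \<and> 0 \<le> Re (ip u u)"
    and ip_self_eq_0: "ip u u = 0 \<Longrightarrow> u = 0"

definition ip_norm :: "('v \<Rightarrow> 'v \<Rightarrow> complex) \<Rightarrow> 'v \<Rightarrow> real" where
  "ip_norm ip v = sqrt (Re (ip v v))"

lemma complex_inner_product_space_complex:
  "complex_inner_product_space (*) (\<lambda>a b. a * cnj b)"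
proof unfold_locales
  fix u :: complex
  show "u * cnj u \<in> \<real> \<and> 0 \<le> Re (u * cnj u)"
    by (simp add: complex_mult_cnj)
qed (auto simp: algebra_simps)

text \<open>\<open>Max {}\<close> is unspecified in HOL; an empty maximum is read as \<open>0\<close>.\<close>

definition Max0 :: "real set \<Rightarrow> real" where
  "Max0 S = (if S = {} then 0 else Max S)"

end

theory Submission
  imports Defs
begin

text \<open>
  Put \<open>c\<^sub>i = (x, y\<^sub>i)\<close>, \<open>v = \<Sum>\<^sub>i c\<^sub>i y\<^sub>i\<close> and \<open>S = \<Sum>\<^sub>i \<bar>c\<^sub>i\<bar>\<^sup>2\<close>.  Then \<open>(x, v) = S\<close>, so expanding
  \<open>\<parallel>x - t v\<parallel>\<^sup>2 \<ge> 0\<close> gives \<open>0 \<le> \<parallel>x\<parallel>\<^sup>2 - 2 t S + t\<^sup>2 \<parallel>v\<parallel>\<^sup>2\<close> for all real \<open>t\<close>.  On the other hand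
  \<open>\<parallel>v\<parallel>\<^sup>2\<close> is the Gram form of the \<open>y\<^sub>i\<close> at the coefficients \<open>c\<^sub>i\<close>, hence is at most
  \<open>\<Sum>\<^sub>i\<^sub>j \<bar>c\<^sub>i\<bar> \<bar>c\<^sub>j\<bar> \<bar>(y\<^sub>i, y\<^sub>j)\<bar>\<close>, and bounding the diagonal and the off-diagonal entries separately
  makes this at most \<open>K S\<close>, where \<open>K\<close> is the factor in braces (\<open>gram_form_le\<close>).  For \<open>K > 0\<close> and
  \<open>t = 1 / K\<close> the quadratic inequality becomes \<open>S \<le> \<parallel>x\<parallel>\<^sup>2 K\<close> (\<open>le_mult_if_quadratic_nonneg\<close>).

  Only the moduli of the scalars enter the last two steps, so they are carried out once, for real
  numbers (\<open>sum_squares_le_if_gram_quadratic\<close>).  What is left for each scalar field is the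
  expansion of \<open>\<parallel>x - t v\<parallel>\<^sup>2\<close>.
\<close>

section \<open>The estimate for real coefficients\<close>

text \<open>
  By \<open>a\<^sub>i a\<^sub>j \<le> (a\<^sub>i\<^sup>2 + a\<^sub>j\<^sup>2) / 2\<close> and symmetry, the form is bounded by the common row sum of the
  matrix with \<open>M\<close> on the diagonal and \<open>m\<close> elsewhere, times \<open>\<Sum>\<^sub>i a\<^sub>i\<^sup>2\<close>.
\<close>

lemma gram_form_le:
  fixes a :: "'i \<Rightarrow> real" and g :: "'i \<Rightarrow> 'i \<Rightarrow> real"
  assumes fin: "finite I"
    and a: "\<And>i. i \<in> I \<Longrightarrow> 0 \<le> a i"
    and diag: "\<And>i. i \<in> I \<Longrightarrow> g i i \<le> M"
    and off: "\<And>i j. i \<in> I \<Longrightarrow> j \<in> I \<Longrightarrow> i \<noteq> j \<Longrightarrow> g i j \<le> m"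
    and m: "0 \<le> m"
  shows "(\<Sum>i\<in>I. \<Sum>j\<in>I. a i * a j * g i j) \<le> (M + (real (card I) - 1) * m) * (\<Sum>i\<in>I. (a i)\<^sup>2)"
proof -
  define e where "e i j = (if i = j then M else m)" for i j :: 'i
  have row: "(\<Sum>j\<in>I. e i j) = M + (real (card I) - 1) * m" if "i \<in> I" for i
  proof -
    have "(\<Sum>j\<in>I. e i j) = e i i + (\<Sum>j\<in>I - {i}. e i j)"
      using fin that by (rule sum.remove)
    also have "(\<Sum>j\<in>I - {i}. e i j) = (\<Sum>j\<in>I - {i}. m)"
      by (rule sum.cong) (auto simp: e_def)
    also have "card I \<ge> 1"
      using fin that by (auto simp: Suc_le_eq card_gt_0_iff)
    then have "(\<Sum>j\<in>I - {i}. m) = (real (card I) - 1) * m"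
      using fin that by (simp add: of_nat_diff)
    finally show ?thesis by (simp add: e_def)
  qed
  have entry: "a i * a j * g i j \<le> e i j * (((a i)\<^sup>2 + (a j)\<^sup>2) / 2)" if "i \<in> I" "j \<in> I" for i j
  proof (cases "i = j")
    case True
    then show ?thesis
      using mult_right_mono[OF diag[OF that(1)], of "(a i)\<^sup>2"]
      by (simp add: e_def power2_eq_square mult.commute)
  next
    case False
    have "a i * a j * g i j \<le> a i * a j * m"
      using False that by (intro mult_left_mono off mult_nonneg_nonneg a)
    also have "a i * a j \<le> ((a i)\<^sup>2 + (a j)\<^sup>2) / 2"
      using sum_squares_bound[of "a i" "a j"] by simp
    then have "a i * a j * m \<le> ((a i)\<^sup>2 + (a j)\<^sup>2) / 2 * m"
      using m by (rule mult_right_mono)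
    finally show ?thesis using False by (simp add: e_def mult.commute)
  qed
  have "(\<Sum>i\<in>I. \<Sum>j\<in>I. a i * a j * g i j)
      \<le> (\<Sum>i\<in>I. \<Sum>j\<in>I. e i j * (((a i)\<^sup>2 + (a j)\<^sup>2) / 2))"
    by (intro sum_mono entry)
  also have "\<dots> = (\<Sum>i\<in>I. \<Sum>j\<in>I. e i j * (a i)\<^sup>2) / 2 + (\<Sum>i\<in>I. \<Sum>j\<in>I. e i j * (a j)\<^sup>2) / 2"
    by (simp add: sum.distrib sum_divide_distrib distrib_left add_divide_distrib)
  also have "(\<Sum>i\<in>I. \<Sum>j\<in>I. e i j * (a j)\<^sup>2) = (\<Sum>j\<in>I. \<Sum>i\<in>I. e j i * (a j)\<^sup>2)"
    by (subst sum.swap) (simp add: e_def eq_commute)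
  also have "(\<Sum>i\<in>I. \<Sum>j\<in>I. e i j * (a i)\<^sup>2) / 2 + \<dots> / 2 = (\<Sum>i\<in>I. (\<Sum>j\<in>I. e i j) * (a i)\<^sup>2)"
    by (simp add: sum_distrib_right)
  also have "\<dots> = (M + (real (card I) - 1) * m) * (\<Sum>i\<in>I. (a i)\<^sup>2)"
    by (simp add: row sum_distrib_left)
  finally show ?thesis .
qed

text \<open>
  For \<open>K > 0\<close> the choice \<open>t = 1 / K\<close> suffices.  For \<open>K = 0\<close> the quadratic term is nonpositive, so a
  positive \<open>S\<close> would make the quadratic expression negative for large \<open>t\<close>.
\<close>

lemma le_mult_if_quadratic_nonneg:
  fixes N S Q K :: real
  assumes quad: "\<And>t. 0 \<le> N - 2 * t * S + t\<^sup>2 * Q"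
    and Q: "Q \<le> K * S" and K: "0 \<le> K"
  shows "S \<le> N * K"
proof (cases "K = 0")
  case True
  show ?thesis
  proof (rule ccontr)
    assume "\<not> S \<le> N * K"
    with True have "S > 0" by simp
    define t where "t = (N + 1) / (2 * S)"
    have "2 * t * S = N + 1" using \<open>S > 0\<close> by (simp add: t_def)
    moreover have "t\<^sup>2 * Q \<le> 0" using Q True by (simp add: mult_nonneg_nonpos)
    ultimately show False using quad[of t] by linarith
  qed
next
  case False
  with K have "K > 0" by simp
  have "(1 / K)\<^sup>2 * Q \<le> (1 / K)\<^sup>2 * (K * S)"
    by (intro mult_left_mono Q) simp
  also have "\<dots> = S / K" using \<open>K > 0\<close> by (simp add: power2_eq_square)
  finally have "S / K \<le> N" using quad[of "1 / K"] by simp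
  then show ?thesis using \<open>K > 0\<close> by (simp add: divide_le_eq)
qed

lemma le_Max0: "finite S \<Longrightarrow> s \<in> S \<Longrightarrow> s \<le> Max0 S"
  by (auto simp: Max0_def)

lemma Max0_nonneg: "finite S \<Longrightarrow> (\<And>s. s \<in> S \<Longrightarrow> 0 \<le> s) \<Longrightarrow> 0 \<le> Max0 S"
  by (auto simp: Max0_def)

text \<open>
  Intended for \<open>a i = \<bar>(x, y\<^sub>i)\<bar>\<close>, \<open>g i j = \<bar>(y\<^sub>i, y\<^sub>j)\<bar>\<close> and \<open>N = \<parallel>x\<parallel>\<^sup>2\<close>.
\<close>

lemma sum_squares_le_if_gram_quadratic:
  fixes a :: "'i \<Rightarrow> real" and g :: "'i \<Rightarrow> 'i \<Rightarrow> real" and N :: real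
  assumes fin: "finite I" and ne: "I \<noteq> {}"
    and a: "\<And>i. i \<in> I \<Longrightarrow> 0 \<le> a i"
    and g: "\<And>i j. i \<in> I \<Longrightarrow> j \<in> I \<Longrightarrow> 0 \<le> g i j"
    and quad: "\<And>t. 0 \<le> N - 2 * t * (\<Sum>i\<in>I. (a i)\<^sup>2) + t\<^sup>2 * (\<Sum>i\<in>I. \<Sum>j\<in>I. a i * a j * g i j)"
  shows "(\<Sum>i\<in>I. (a i)\<^sup>2) \<le> N * (Max {g i i | i. i \<in> I}
           + (real (card I) - 1) * Max0 {g i j | i j. i \<in> I \<and> j \<in> I \<and> i \<noteq> j})"
proof -
  define M where "M = Max {g i i | i. i \<in> I}"
  define m where "m = Max0 {g i j | i j. i \<in> I \<and> j \<in> I \<and> i \<noteq> j}"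
  have fin_diag: "finite {g i i | i. i \<in> I}"
    using fin by simp
  have "{g i j | i j. i \<in> I \<and> j \<in> I \<and> i \<noteq> j} \<subseteq> (\<lambda>(i, j). g i j) ` (I \<times> I)"
    by auto
  then have fin_off: "finite {g i j | i j. i \<in> I \<and> j \<in> I \<and> i \<noteq> j}"
    by (rule finite_subset) (simp add: fin)
  have diag: "g i i \<le> M" if "i \<in> I" for i
    unfolding M_def using fin_diag that by (intro Max_ge) auto
  have off: "g i j \<le> m" if "i \<in> I" "j \<in> I" "i \<noteq> j" for i j
    unfolding m_def using fin_off that by (intro le_Max0) auto
  have m: "0 \<le> m"
    unfolding m_def using fin_off by (rule Max0_nonneg) (auto intro: g)
  obtain i where "i \<in> I" using ne by blast
  then have "0 \<le> M" using g[of i i] diag[of i] by linarith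
  moreover have "1 \<le> card I"
    using fin ne by (simp add: Suc_leI card_gt_0_iff)
  ultimately have "0 \<le> M + (real (card I) - 1) * m"
    using m by simp
  with quad gram_form_le[OF fin a diag off m]
  show ?thesis
    unfolding M_def[symmetric] m_def[symmetric] by (rule le_mult_if_quadratic_nonneg)
qed

section \<open>Real inner product spaces\<close>

lemma real_gram_quadratic_nonneg:
  fixes x :: "'a::real_inner" and y :: "'i \<Rightarrow> 'a"
  shows "0 \<le> (norm x)\<^sup>2 - 2 * t * (\<Sum>i\<in>I. \<bar>inner x (y i)\<bar>\<^sup>2)
    + t\<^sup>2 * (\<Sum>i\<in>I. \<Sum>j\<in>I. \<bar>inner x (y i)\<bar> * \<bar>inner x (y j)\<bar> * \<bar>inner (y i) (y j)\<bar>)"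
proof -
  define c where "c i = inner x (y i)" for i
  define v where "v = (\<Sum>i\<in>I. c i *\<^sub>R y i)"
  have xv: "inner x v = (\<Sum>i\<in>I. \<bar>c i\<bar>\<^sup>2)"
    by (simp add: v_def inner_sum_right c_def power2_eq_square)
  have "inner v v = (\<Sum>i\<in>I. \<Sum>j\<in>I. c i * c j * inner (y i) (y j))"
    by (simp add: v_def inner_sum_left inner_sum_right sum_distrib_left mult.assoc
        mult.left_commute inner_commute)
  also have "\<dots> \<le> (\<Sum>i\<in>I. \<Sum>j\<in>I. \<bar>c i\<bar> * \<bar>c j\<bar> * \<bar>inner (y i) (y j)\<bar>)"
    by (intro sum_mono) (metis abs_ge_self abs_mult)
  finally have vv: "t\<^sup>2 * inner v v \<le> t\<^sup>2 * (\<Sum>i\<in>I. \<Sum>j\<in>I. \<bar>c i\<bar> * \<bar>c j\<bar> * \<bar>inner (y i) (y j)\<bar>)"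
    by (intro mult_left_mono) auto
  have "0 \<le> inner (x - t *\<^sub>R v) (x - t *\<^sub>R v)" by simp
  also have "\<dots> = (norm x)\<^sup>2 - 2 * t * inner x v + t\<^sup>2 * inner v v"
    unfolding power2_norm_eq_inner
    by (simp add: inner_diff_left inner_diff_right inner_commute[of v x]
        power2_eq_square algebra_simps)
  finally show ?thesis
    using vv unfolding xv c_def by linarith
qed

section \<open>Complex inner product spaces\<close>

context complex_inner_product_space
begin

lemma ip_add_right: "ip w (u + v) = ip w u + ip w v"
  by (metis ip_add_left ip_commute complex_cnj_add)

lemma ip_scale_right: "ip w (scale c u) = cnj c * ip w u"
  by (metis ip_scale_left ip_commute complex_cnj_mult)

lemma ip_zero_left: "ip 0 w = 0"
  using ip_add_left[of 0 0 w] by simp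

lemma ip_zero_right: "ip w 0 = 0"
  using ip_add_right[of w 0 0] by simp

lemma ip_sum_left: "ip (\<Sum>i\<in>I. f i) w = (\<Sum>i\<in>I. ip (f i) w)"
  by (induction I rule: infinite_finite_induct) (simp_all add: ip_zero_left ip_add_left)

lemma ip_sum_right: "ip w (\<Sum>i\<in>I. f i) = (\<Sum>i\<in>I. ip w (f i))"
  by (induction I rule: infinite_finite_induct) (simp_all add: ip_zero_right ip_add_right)

lemma ip_norm_squared: "(ip_norm ip v)\<^sup>2 = Re (ip v v)"
  by (simp add: ip_norm_def ip_self_nonneg)

lemma cmod_ip_self: "cmod (ip v v) = (ip_norm ip v)\<^sup>2"
  using ip_self_nonneg[of v] by (auto simp: ip_norm_squared elim!: Reals_cases)

lemma complex_gram_quadratic_nonneg: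
  "0 \<le> (ip_norm ip u)\<^sup>2 - 2 * t * (\<Sum>i\<in>I. (cmod (ip u (w i)))\<^sup>2)
    + t\<^sup>2 * (\<Sum>i\<in>I. \<Sum>j\<in>I. cmod (ip u (w i)) * cmod (ip u (w j)) * cmod (ip (w i) (w j)))"
proof -
  define c where "c i = ip u (w i)" for i
  define v where "v = (\<Sum>i\<in>I. scale (c i) (w i))"
  have uv: "ip u v = of_real (\<Sum>i\<in>I. (cmod (c i))\<^sup>2)"
    by (simp add: v_def ip_sum_right ip_scale_right c_def mult.commute flip: complex_norm_square)
  have vu: "ip v u = of_real (\<Sum>i\<in>I. (cmod (c i))\<^sup>2)"
    using uv by (metis ip_commute complex_cnj_complex_of_real)
  have "ip v v = (\<Sum>i\<in>I. \<Sum>j\<in>I. c i * (cnj (c j) * ip (w i) (w j)))"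
    by (simp add: v_def ip_sum_left ip_sum_right ip_scale_left ip_scale_right sum_distrib_left
        mult.left_commute)
      (rule sum.swap)
  then have "Re (ip v v) = (\<Sum>i\<in>I. \<Sum>j\<in>I. Re (c i * (cnj (c j) * ip (w i) (w j))))"
    by simp
  also have "\<dots> \<le> (\<Sum>i\<in>I. \<Sum>j\<in>I. cmod (c i) * cmod (c j) * cmod (ip (w i) (w j)))"
    by (intro sum_mono order.trans[OF complex_Re_le_cmod]) (simp add: norm_mult)
  finally have vv: "t\<^sup>2 * Re (ip v v)
      \<le> t\<^sup>2 * (\<Sum>i\<in>I. \<Sum>j\<in>I. cmod (c i) * cmod (c j) * cmod (ip (w i) (w j)))"
    by (intro mult_left_mono) auto
  let ?z = "u + scale (- of_real t) v"
  have "ip ?z ?z = ip u u - of_real t * (ip u v + ip v u) + of_real (t\<^sup>2) * ip v v"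
    by (simp add: ip_add_left ip_add_right ip_scale_left ip_scale_right power2_eq_square
        algebra_simps del: scale_minus_left)
  then have "Re (ip ?z ?z)
      = (ip_norm ip u)\<^sup>2 - 2 * t * (\<Sum>i\<in>I. (cmod (c i))\<^sup>2) + t\<^sup>2 * Re (ip v v)"
    unfolding uv vu ip_norm_squared by (simp del: of_real_sum of_real_power)
  then show ?thesis
    using vv ip_self_nonneg[of ?z] unfolding c_def by linarith
qed

end

section \<open>The inequality over both scalar fields\<close>

theorem mainTheorem3:
  fixes n :: nat
    and x :: "'a::real_inner" and y :: "nat \<Rightarrow> 'a"
    and scale :: "complex \<Rightarrow> 'v::ab_group_add \<Rightarrow> 'v" and ip :: "'v \<Rightarrow> 'v \<Rightarrow> complex"
    and u :: 'v and w :: "nat \<Rightarrow> 'v"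
  assumes "n \<ge> 1"
  shows "(\<Sum>i=1..n. \<bar>inner x (y i)\<bar>\<^sup>2)
           \<le> (norm x)\<^sup>2 * (Max {(norm (y i))\<^sup>2 | i. i \<in> {1..n}}
               + (real n - 1) * Max0 {\<bar>inner (y i) (y j)\<bar> | i j. i \<in> {1..n} \<and> j \<in> {1..n} \<and> i \<noteq> j})
       \<and> (complex_inner_product_space scale ip \<longrightarrow>
          (\<Sum>i=1..n. (cmod (ip u (w i)))\<^sup>2)
           \<le> (ip_norm ip u)\<^sup>2 * (Max {(ip_norm ip (w i))\<^sup>2 | i. i \<in> {1..n}}
               + (real n - 1) * Max0 {cmod (ip (w i) (w j)) | i j. i \<in> {1..n} \<and> j \<in> {1..n} \<and> i \<noteq> j}))"
proof (intro conjI impI)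
  have I: "finite {1..n}" "{1..n} \<noteq> {}" using assms by auto
  show "(\<Sum>i=1..n. \<bar>inner x (y i)\<bar>\<^sup>2)
      \<le> (norm x)\<^sup>2 * (Max {(norm (y i))\<^sup>2 | i. i \<in> {1..n}}
          + (real n - 1) * Max0 {\<bar>inner (y i) (y j)\<bar> | i j. i \<in> {1..n} \<and> j \<in> {1..n} \<and> i \<noteq> j})"
    using sum_squares_le_if_gram_quadratic[OF I abs_ge_zero abs_ge_zero real_gram_quadratic_nonneg,
        of x y]
    by (simp add: power2_norm_eq_inner)
next
  assume "complex_inner_product_space scale ip"
  then interpret complex_inner_product_space scale ip .
  have I: "finite {1..n}" "{1..n} \<noteq> {}" using assms by auto
  show "(\<Sum>i=1..n. (cmod (ip u (w i)))\<^sup>2)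
      \<le> (ip_norm ip u)\<^sup>2 * (Max {(ip_norm ip (w i))\<^sup>2 | i. i \<in> {1..n}}
          + (real n - 1) * Max0 {cmod (ip (w i) (w j)) | i j. i \<in> {1..n} \<and> j \<in> {1..n} \<and> i \<noteq> j})"
    using sum_squares_le_if_gram_quadratic[OF I norm_ge_zero norm_ge_zero
        complex_gram_quadratic_nonneg, of u w]
    by (simp add: cmod_ip_self)
qed

end
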